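(* Let $G(\mathcal V,\mathcal E,\mathcal C)$ be a multicost network with $d$ cost criteria, let $s,t\in\mathcal V$ be the start and target node of a path skyline query, and let $G_{\mathrm{SOL}}(s,t)$ be its solution graph. For a node $n$ of $G_{\mathrm{SOL}}(s,t)$ and a criterion $i\in\{1,\dots,d\}$, let $p_i(n,t)$ denote a shortest path from $n$ to $t$ in $G_{\mathrm{SOL}}(s,t)$ with respect to cost criterion $i$, and let $lb(n,t)_i$ be the value computed by the algorithm ParetoPrep (on input $s,t$, upon termination) for $n$ and $i$. Then $$lb(n,t)_i \le cost(p_i(n,t))_i .$$
   Context: A multicost network is a finite directed graph $G(\mathcal V,\mathcal E,\mathcal C)$ with $\mathcal E\subseteq\mathcal V\times\mathcal V$ in which each edge $(n,m)$ carries a cost vector $cost(n,m)\in\mathbb R_+^d$ (nonnegative entries). A path from $a$ to $b$ is a sequence of adjacent edges from $a$ to $b$ that visits no node twice; its cost in criterion $i$ is $cost(p)_i=\sum_{(n,m)\in p}cost(n,m)_i$. The trivial path (no edges) from a node to itself has cost $0$. A vector $a$ dominates a vector $b$, written $a\prec_{\mathrm{dom}} b$, iff $a_i<b_i$ for some $i$ and there is no $j$ with $a_j>b_j$. For a set $A$ of paths and a vector $b$, $A\prec_{\mathrm{dom}} b$ means that $cost(a)\prec_{\mathrm{dom}} b$ for some $a\in A$. The path skyline $\mathcal S(s,t)$ is the set of all paths from $s$ to $t$ whose cost vectors are not dominated by the cost vector of any path from $s$ to $t$. Solution graph: $\mathcal E_{\mathrm{SOL}}(s,t)$ is the set of all edges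 contained in some $p\in\mathcal S(s,t)$; $\mathcal V_{\mathrm{SOL}}$ is the set of endpoints of these edges; $G_{\mathrm{SOL}}(s,t)$ is the graph with these nodes and edges and with the costs of $G$ restricted to $\mathcal E_{\mathrm{SOL}}(s,t)$. ParetoPrep (input $s,t$). Each node $n$ has a vector $lb(n,t)\in[0,\infty]^d$ and successor edges $succ_1(n),\dots,succ_d(n)$. Initially $lb(t,t)=0$, $lb(n,t)_i=\infty$ for all $n\ne t$ and all $i$, and all successors are undefined. Step 1: set $P:=\emptyset$ (a set of paths from $s$ to $t$) and $open:=\{t\}$. While $open\neq\emptyset$ repeat Steps 2-5: Step 2: choose $n\in open$ minimizing $\sum_{i=1}^d lb(n,t)_i$ (ties broken arbitrarily) and remove it from $open$. Step 3: if $P\prec_{\mathrm{dom}} lb(n,t)$, skip Steps 4 and 5 for this iteration. Step 4: for each incoming edge $(m,n)$ of $n$ and each criterion $i$: if $lb(n,t)_i+cost(m,n)_i<lb(m,t)_i$, then set $lb(m,t)_i:=lb(n,t)_i+cost(m,n)_i$, set $succ_i(m):=(m,n)$, and add $m$ to $open$. Step 5: for each component $i$ of $lb(s,t)$ modified in Step 4, let $p$ be the path obtained by starting at $s$ and repeatedly following the edges $succ_i(\cdot)$ until $t$ is reached; add $p$ to $P$ and remove from $P$ all paths dominated by $p$. When $open$ is empty, return $P$ and $lb$. *)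

theory Defs
  imports "HOL-Analysis.Finite_Cartesian_Product" "HOL-Library.Extended_Real"
    "Graph_Theory.Pair_Digraph"
begin

text \<open>
  A path is the list of its edges; \<open>pre_digraph.apath G a p b\<close> says that \<open>p\<close> is a path from
  \<open>a\<close> to \<open>b\<close> in \<open>G\<close> visiting no node twice (the trivial path is \<open>[]\<close>). The \<open>d\<close> criteria are
  indexed by a finite type \<open>'d\<close>.
\<close>

locale multicost_network = pair_fin_digraph G
  for G :: "'v pair_pre_digraph" +
  fixes c :: "'v \<times> 'v \<Rightarrow> real ^ 'd"
  assumes cost_nonneg: "e \<in> parcs G \<Longrightarrow> 0 \<le> c e $ i"

definition path_cost :: "('v \<times> 'v \<Rightarrow> real ^ 'd::finite) \<Rightarrow> ('v \<times> 'v) list \<Rightarrow> real ^ 'd" where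
  "path_cost c p = (\<chi> i. \<Sum>e\<leftarrow>p. c e $ i)"

definition dominates :: "'a::linorder ^ 'd \<Rightarrow> 'a ^ 'd \<Rightarrow> bool" where
  "dominates a b \<longleftrightarrow> (\<exists>i. a $ i < b $ i) \<and> \<not> (\<exists>j. a $ j > b $ j)"

text \<open>The vector on the right may have infinite entries, so path costs are embedded into \<open>ereal\<close>.\<close>

definition set_dominates ::
    "('v \<times> 'v \<Rightarrow> real ^ 'd::finite) \<Rightarrow> ('v \<times> 'v) list set \<Rightarrow> ereal ^ 'd \<Rightarrow> bool" where
  "set_dominates c A b \<longleftrightarrow> (\<exists>p\<in>A. dominates (\<chi> i. ereal (path_cost c p $ i)) b)"

definition skyline ::
    "'v pair_pre_digraph \<Rightarrow> ('v \<times> 'v \<Rightarrow> real ^ 'd::finite) \<Rightarrow> 'v \<Rightarrow> 'v \<Rightarrow> ('v \<times> 'v) list set" where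
  "skyline G c s t = {p. pre_digraph.apath G s p t \<and>
     \<not> (\<exists>q. pre_digraph.apath G s q t \<and> dominates (path_cost c q) (path_cost c p))}"

definition sol_edges ::
    "'v pair_pre_digraph \<Rightarrow> ('v \<times> 'v \<Rightarrow> real ^ 'd::finite) \<Rightarrow> 'v \<Rightarrow> 'v \<Rightarrow> ('v \<times> 'v) set" where
  "sol_edges G c s t = (\<Union>p\<in>skyline G c s t. set p)"

text \<open>The edge costs of the solution graph are those of \<open>G\<close>, so \<open>c\<close> itself is used for them.\<close>

definition sol_graph ::
    "'v pair_pre_digraph \<Rightarrow> ('v \<times> 'v \<Rightarrow> real ^ 'd::finite) \<Rightarrow> 'v \<Rightarrow> 'v \<Rightarrow> 'v pair_pre_digraph" where
  "sol_graph G c s t =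
     \<lparr>pverts = fst ` sol_edges G c s t \<union> snd ` sol_edges G c s t, parcs = sol_edges G c s t\<rparr>"

definition shortest_path ::
    "'v pair_pre_digraph \<Rightarrow> ('v \<times> 'v \<Rightarrow> real ^ 'd::finite) \<Rightarrow> 'd \<Rightarrow> 'v \<Rightarrow> ('v \<times> 'v) list \<Rightarrow> 'v \<Rightarrow> bool" where
  "shortest_path G c i n p t \<longleftrightarrow> pre_digraph.apath G n p t \<and>
     (\<forall>q. pre_digraph.apath G n q t \<longrightarrow> path_cost c p $ i \<le> path_cost c q $ i)"

subsection \<open>ParetoPrep\<close>

text \<open>The target \<open>t\<close> is fixed, so the vector \<open>lb(n,t)\<close> is \<open>lbs n\<close>; undefined successors are \<open>None\<close>.\<close>

record ('v, 'd) pp_state =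
  lbs :: "'v \<Rightarrow> ereal ^ 'd"
  succs :: "'d \<Rightarrow> 'v \<Rightarrow> ('v \<times> 'v) option"
  paths :: "('v \<times> 'v) list set"
  opens :: "'v set"

definition pp_init :: "'v \<Rightarrow> ('v, 'd::finite) pp_state" where
  "pp_init t = \<lparr>lbs = (\<lambda>n. if n = t then (\<chi> i. 0) else (\<chi> i. \<infinity>)), succs = (\<lambda>i n. None),
     paths = {}, opens = {t}\<rparr>"

definition improves ::
    "'v pair_pre_digraph \<Rightarrow> ('v \<times> 'v \<Rightarrow> real ^ 'd::finite) \<Rightarrow> ('v \<Rightarrow> ereal ^ 'd::finite) \<Rightarrow> 'v \<Rightarrow> 'v \<Rightarrow> 'd \<Rightarrow> bool" where
  "improves G c l n m i \<longleftrightarrow> (m, n) \<in> parcs G \<and> l n $ i + ereal (c (m, n) $ i) < l m $ i"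

text \<open>
  The loop over all incoming edges \<open>(m, n)\<close> and all criteria is carried out at once. This agrees
  with processing them one after the other in any order: the pair \<open>(m, i)\<close> only reads entry \<open>i\<close> of
  the vectors at \<open>n\<close> and \<open>m\<close> and only writes entry \<open>i\<close> at \<open>m\<close>; distinct pairs write distinct
  entries, and entries at \<open>n\<close> are never changed, as a self-loop of nonnegative cost improves nothing.
\<close>

definition relax ::
    "'v pair_pre_digraph \<Rightarrow> ('v \<times> 'v \<Rightarrow> real ^ 'd::finite) \<Rightarrow> 'v \<Rightarrow> ('v, 'd::finite) pp_state \<Rightarrow> ('v, 'd::finite) pp_state" where
  "relax G c n st = st
     \<lparr>lbs := (\<lambda>m. \<chi> i. if improves G c (lbs st) n m i then lbs st n $ i + ereal (c (m, n) $ i)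
                      else lbs st m $ i),
      succs := (\<lambda>i m. if improves G c (lbs st) n m i then Some (m, n) else succs st i m),
      opens := opens st \<union> {m. \<exists>i. improves G c (lbs st) n m i}\<rparr>"

text \<open>\<open>follow f t v p\<close>: following the edges \<open>f\<close> from \<open>v\<close> until \<open>t\<close> is reached yields \<open>p\<close>.\<close>

inductive follow ::
    "('v \<Rightarrow> ('v \<times> 'v) option) \<Rightarrow> 'v \<Rightarrow> 'v \<Rightarrow> ('v \<times> 'v) list \<Rightarrow> bool" for f t where
  reached: "follow f t t []"
| edge: "v \<noteq> t \<Longrightarrow> f v = Some e \<Longrightarrow> follow f t (snd e) p \<Longrightarrow> follow f t v (e # p)"

definition add_path ::
    "('v \<times> 'v \<Rightarrow> real ^ 'd::finite) \<Rightarrow> ('v \<times> 'v) list \<Rightarrow> ('v \<times> 'v) list set \<Rightarrow> ('v \<times> 'v) list set" where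
  "add_path c p P = {q \<in> insert p P. \<not> dominates (path_cost c p) (path_cost c q)}"

text \<open>
  One iteration of the loop. Both the choice of \<open>n\<close> among the minimizers and the order \<open>is\<close> in which
  the modified components of the vector at \<open>s\<close> are processed are left open; the latter can
  influence the resulting set of paths.
\<close>

inductive pp_step ::
    "'v pair_pre_digraph \<Rightarrow> ('v \<times> 'v \<Rightarrow> real ^ 'd::finite) \<Rightarrow> 'v \<Rightarrow> 'v \<Rightarrow>
     ('v, 'd::finite) pp_state \<Rightarrow> ('v, 'd::finite) pp_state \<Rightarrow> bool" for G c s t where
  skip: "pp_step G c s t st (st\<lparr>opens := opens st - {n}\<rparr>)"
    if "n \<in> opens st" "\<forall>m\<in>opens st. (\<Sum>i\<in>UNIV. lbs st n $ i) \<le> (\<Sum>i\<in>UNIV. lbs st m $ i)"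
       "set_dominates c (paths st) (lbs st n)"
| expand: "pp_step G c s t st (st'\<lparr>paths := fold (add_path c) ps (paths st)\<rparr>)"
    if "n \<in> opens st" "\<forall>m\<in>opens st. (\<Sum>i\<in>UNIV. lbs st n $ i) \<le> (\<Sum>i\<in>UNIV. lbs st m $ i)"
       "\<not> set_dominates c (paths st) (lbs st n)"
       "st' = relax G c n (st\<lparr>opens := opens st - {n}\<rparr>)"
       "distinct is" "set is = {i. lbs st' s $ i \<noteq> lbs st s $ i}"
       "list_all2 (\<lambda>i p. follow (succs st' i) t s p) is ps"

text \<open>\<open>P\<close> and \<open>lb\<close> are a possible result of a terminating run on input \<open>s\<close>, \<open>t\<close>.\<close>

definition pareto_prep ::
    "'v pair_pre_digraph \<Rightarrow> ('v \<times> 'v \<Rightarrow> real ^ 'd::finite) \<Rightarrow> 'v \<Rightarrow> 'v \<Rightarrow>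
     ('v \<times> 'v) list set \<Rightarrow> ('v \<Rightarrow> ereal ^ 'd::finite) \<Rightarrow> bool" where
  "pareto_prep G c s t P lb \<longleftrightarrow>
     (\<exists>st. (pp_step G c s t)\<^sup>*\<^sup>* (pp_init t) st \<and> opens st = {} \<and> P = paths st \<and> lb = lbs st)"

end

theory Submission
  imports Defs
begin

text \<open>
  At termination every node \<open>v\<close> either has all its incoming edges relaxed or was pruned because
  some path found by the algorithm dominates \<open>lb(v,t)\<close>. Going backwards from \<open>t\<close> along a skyline
  path \<open>q\<close>, the vector \<open>lb(v,t)\<close> stays below the cost of the remaining suffix of \<open>q\<close>, hence below the
  cost of \<open>q\<close> itself; so pruning \<open>v\<close> would exhibit a path dominating \<open>q\<close>. Thus all nodes of the
  solution graph have their incoming edges relaxed, and the bound propagates along any path of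
  the solution graph, even one that is not part of a single skyline path.
\<close>

section \<open>Path costs and domination\<close>

lemma path_cost_Nil [simp]: "path_cost c [] $ i = 0"
  by (simp add: path_cost_def)

lemma path_cost_Cons [simp]: "path_cost c (e # p) $ i = c e $ i + path_cost c p $ i"
  by (simp add: path_cost_def)

lemma path_cost_append [simp]: "path_cost c (p @ q) $ i = path_cost c p $ i + path_cost c q $ i"
  by (simp add: path_cost_def)

lemma path_cost_nonneg:
  assumes "\<And>e. e \<in> set p \<Longrightarrow> 0 \<le> c e $ i"
  shows "0 \<le> path_cost c p $ i"
  unfolding path_cost_def using assms by (auto intro!: sum_list_nonneg)

lemma dominates_le:
  assumes "dominates a b" "\<And>j. b $ j \<le> b' $ j"
  shows "dominates a b'"
  using assms unfolding dominates_def by (meson leD leI less_le_trans)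

lemma dominates_trans:
  assumes "dominates a b" "dominates b b'"
  shows "dominates a b'"
  using assms by (meson dominates_def dominates_le leI)

lemma dominates_ereal:
  "dominates (\<chi> i. ereal (a $ i)) (\<chi> i. ereal (b $ i)) \<longleftrightarrow> dominates a b"
  by (simp add: dominates_def)

text \<open>A path removed from \<open>P\<close> is dominated by \<open>p\<close>, and
  \<open>p\<close> itself is kept, so transitivity lets \<open>p\<close> take over. Hence a node
  once pruned stays dominated while \<open>P\<close> changes.\<close>

lemma set_dominates_add_path:
  assumes "set_dominates c P b"
  shows "set_dominates c (add_path c p P) b"
proof -
  obtain q where q: "q \<in> P" "dominates (\<chi> i. ereal (path_cost c q $ i)) b"
    using assms by (auto simp: set_dominates_def)
  show ?thesis
  proof (cases "dominates (path_cost c p) (path_cost c q)")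
    case True
    have "p \<in> add_path c p P"
      by (auto simp: add_path_def dominates_def)
    moreover have "dominates (\<chi> i. ereal (path_cost c p $ i)) b"
      using True q(2) dominates_ereal dominates_trans by blast
    ultimately show ?thesis by (auto simp: set_dominates_def)
  next
    case False
    with q show ?thesis by (auto simp: set_dominates_def add_path_def)
  qed
qed

lemma set_dominates_fold_add_path:
  "set_dominates c P b \<Longrightarrow> set_dominates c (fold (add_path c) ps P) b"
  by (induction ps arbitrary: P) (auto intro: set_dominates_add_path)

lemma fold_add_path_subset: "fold (add_path c) ps P \<subseteq> set ps \<union> P"
proof (induction ps arbitrary: P)
  case (Cons p ps)
  have "fold (add_path c) (p # ps) P \<subseteq> set ps \<union> add_path c p P"
    using Cons by simp
  also have "add_path c p P \<subseteq> insert p P"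
    by (auto simp: add_path_def)
  finally show ?case by auto
qed simp

section \<open>Paths obtained from successor edges\<close>

text \<open>The rules exclude each other, since \<open>edge\<close> demands
  \<open>v \<noteq> t\<close>, and \<open>f\<close> is a function.\<close>

lemma follow_unique:
  assumes "follow f t v p" "follow f t v q"
  shows "p = q"
  using assms
proof (induction arbitrary: q)
  case reached
  then show ?case by (auto elim: follow.cases)
next
  case (edge v e p)
  from edge.prems edge.hyps show ?case
    by (cases rule: follow.cases) (auto intro: edge.IH)
qed

lemma follow_suffix:
  assumes "follow f t v p" "\<And>v e. f v = Some e \<Longrightarrow> fst e = v"
    "u \<in> set (pawalk_verts v p)"
  shows "\<exists>p1 p2. p = p1 @ p2 \<and> follow f t u p2"
  using assms(1,3)
proof (induction)
  case reached
  then show ?case by (auto intro: follow.intros)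
next
  case (edge v e p)
  show ?case
  proof (cases "u = v")
    case True
    with edge.hyps show ?thesis by (metis append_Nil follow.edge)
  next
    case False
    with edge assms(2) have "\<exists>p1 p2. p = p1 @ p2 \<and> follow f t u p2"
      by auto
    then show ?thesis by (metis append_Cons)
  qed
qed

text \<open>A node repeated while following successors would be repeated for ever, so \<open>t\<close> would never
  be reached.\<close>

lemma follow_distinct:
  assumes "follow f t v p" "\<And>v e. f v = Some e \<Longrightarrow> fst e = v"
  shows "distinct (pawalk_verts v p)"
  using assms(1)
proof (induction)
  case reached
  then show ?case by simp
next
  case (edge v e p)
  have "v \<notin> set (pawalk_verts (snd e) p)"
  proof
    assume "v \<in> set (pawalk_verts (snd e) p)"
    then obtain p1 p2 where "p = p1 @ p2" "follow f t v p2"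
      using follow_suffix[OF edge.hyps(3) assms(2)] by blast
    moreover have "follow f t v (e # p)"
      using edge.hyps by (rule follow.edge)
    ultimately have "p2 = e # p1 @ p2"
      using follow_unique by metis
    then have "length p2 = length (e # p1 @ p2)" by metis
    then show False by simp
  qed
  with edge assms(2) show ?case by auto
qed

text \<open>Makes every path added to \<open>P\<close> a genuine path of \<open>G\<close>, hence a
  competitor in the definition of \<open>skyline\<close>.\<close>

lemma follow_apath:
  assumes "follow f t v p" "\<And>v e. f v = Some e \<Longrightarrow> e \<in> parcs G \<and> fst e = v" "v \<in> pverts G"
  shows "pre_digraph.apath (with_proj G) v p t"
proof -
  have "set p \<subseteq> parcs G \<and> pcas v p t"
    using assms(1)
  proof (induction)
    case (edge v e p)
    with assms(2) show ?case by auto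
  qed simp
  moreover have "distinct (pawalk_verts v p)"
    using assms(2) by (intro follow_distinct[OF assms(1)]) blast
  ultimately show ?thesis
    using assms(3)
    by (simp add: pre_digraph.apath_def pre_digraph.awalk_def cas_with_proj_eq awalk_verts_with_proj_eq)
qed

section \<open>The loop invariant\<close>

definition relaxed ::
    "'v pair_pre_digraph \<Rightarrow> ('v \<times> 'v \<Rightarrow> real ^ 'd::finite) \<Rightarrow> ('v \<Rightarrow> ereal ^ 'd) \<Rightarrow> 'v \<Rightarrow> bool" where
  "relaxed G c l v \<longleftrightarrow>
     (\<forall>m i. (m, v) \<in> parcs G \<longrightarrow> l m $ i \<le> l v $ i + ereal (c (m, v) $ i))"

text \<open>The last conjunct says that a closed node was pruned or has its incoming edges relaxed.
  Nodes not yet reached satisfy \<open>relaxed\<close> because their entries are infinite.\<close>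

definition pp_inv ::
    "'v pair_pre_digraph \<Rightarrow> ('v \<times> 'v \<Rightarrow> real ^ 'd::finite) \<Rightarrow> 'v \<Rightarrow> 'v \<Rightarrow> ('v, 'd) pp_state \<Rightarrow> bool" where
  "pp_inv G c s t st \<longleftrightarrow>
     (\<forall>i. lbs st t $ i \<le> 0) \<and>
     (\<forall>i v e. succs st i v = Some e \<longrightarrow> e \<in> parcs G \<and> fst e = v) \<and>
     (\<forall>p\<in>paths st. pre_digraph.apath G s p t) \<and>
     (\<forall>v. v \<in> opens st \<or> set_dominates c (paths st) (lbs st v) \<or> relaxed G c (lbs st) v)"

lemma pp_inv_init: "pp_inv G c s t (pp_init t)"
  by (auto simp: pp_inv_def pp_init_def relaxed_def)

context multicost_network
begin

lemma lbs_relax_le: "lbs (relax G c n st) v $ i \<le> lbs st v $ i"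
  by (auto simp: relax_def improves_def)

text \<open>A changed entry comes from an improvement, which would have put \<open>v\<close> into
  \<open>opens\<close>.\<close>

lemma lbs_relax_eq:
  assumes "v \<notin> opens (relax G c n st)"
  shows "lbs (relax G c n st) v = lbs st v"
  using assms by (auto simp: relax_def vec_eq_iff)

lemma not_improves_self: "\<not> improves G c l n n i"
proof
  assume *: "improves G c l n n i"
  then have "0 \<le> c (n, n) $ i" by (auto simp: improves_def intro: cost_nonneg)
  then have "l n $ i \<le> l n $ i + ereal (c (n, n) $ i)"
    by (simp add: ereal_le_add_self)
  with * show False by (auto simp: improves_def dest: leD)
qed

text \<open>Self-loops improve nothing, so the vector at \<open>n\<close> read during relaxation is
  still the vector at \<open>n\<close> afterwards.\<close>

lemma relaxed_relax: "relaxed G c (lbs (relax G c n st)) n"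
  using not_improves_self[of "lbs st" n] by (auto simp: relaxed_def relax_def improves_def)

lemma pp_inv_step:
  assumes "pp_step G c s t st st'" "pp_inv G c s t st" "s \<in> pverts G"
  shows "pp_inv G c s t st'"
  using assms(1)
proof cases
  case (skip n)
  \<comment> \<open>The removed node \<open>n\<close> is dominated by \<open>paths st\<close>, the
    second alternative of the invariant.\<close>
  with assms(2) show ?thesis by (auto simp: pp_inv_def)
next
  case (expand n st1 "is" ps)
  define st0 where "st0 = st\<lparr>opens := opens st - {n}\<rparr>"
  have st1: "st1 = relax G c n st0" using expand by (simp add: st0_def)
  have paths_st1: "paths st1 = paths st" by (simp add: st1 relax_def st0_def)
  have le: "lbs st1 v $ i \<le> lbs st v $ i" for v i
    using lbs_relax_le[of n st0] by (simp add: st1 st0_def)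
  have "lbs st1 t $ i \<le> 0" for i
    using le[of t i] assms(2) by (auto simp: pp_inv_def intro: order_trans)
  moreover have succs: "e \<in> parcs G \<and> fst e = v" if "succs st1 i v = Some e" for i v e
  proof (cases "improves G c (lbs st) n v i")
    case True
    with that show ?thesis by (auto simp: st1 st0_def relax_def improves_def)
  next
    case False
    with that have "succs st i v = Some e" by (simp add: st1 st0_def relax_def)
    with assms(2) show ?thesis unfolding pp_inv_def by blast
  qed
  moreover have "pre_digraph.apath G s p t" if "p \<in> fold (add_path c) ps (paths st)" for p
  proof -
    have "p \<in> set ps \<or> p \<in> paths st"
      using that fold_add_path_subset by fastforce
    moreover have "pre_digraph.apath G s p t" if "p \<in> set ps"
    proof -
      obtain i where "follow (succs st1 i) t s p"
        using \<open>p \<in> set ps\<close> expand by (auto simp: list_all2_conv_all_nth in_set_conv_nth)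
      then show ?thesis
        using succs assms(3) by (rule follow_apath)
    qed
    ultimately show ?thesis using assms(2) by (auto simp: pp_inv_def)
  qed
  moreover have "set_dominates c (fold (add_path c) ps (paths st)) (lbs st1 v) \<or> relaxed G c (lbs st1) v"
    if v: "v \<notin> opens st1" for v
  proof (cases "v = n")
    case True
    then show ?thesis using relaxed_relax st1 by blast
  next
    case False
    have eq: "lbs st1 v = lbs st v"
      using lbs_relax_eq[of v n st0] v by (simp add: st1 st0_def)
    have "v \<notin> opens st" using v False by (auto simp: st1 st0_def relax_def)
    then consider "set_dominates c (paths st) (lbs st v)" | "relaxed G c (lbs st) v"
      using assms(2) by (auto simp: pp_inv_def)
    then show ?thesis
    proof cases
      case 1
      then show ?thesis by (simp add: eq set_dominates_fold_add_path)
    next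
      case 2
      \<comment> \<open>The vector at \<open>v\<close> is unchanged, while those at its predecessors
        can only decrease.\<close>
      then have "relaxed G c (lbs st1) v"
        using le unfolding relaxed_def eq by (meson order_trans)
      then show ?thesis ..
    qed
  qed
  ultimately show ?thesis
    by (simp add: pp_inv_def expand(1)) blast
qed

lemma pp_inv_reachable:
  assumes "(pp_step G c s t)\<^sup>*\<^sup>* (pp_init t) st" "s \<in> pverts G"
  shows "pp_inv G c s t st"
  using assms(1) by induction (auto intro: pp_inv_init pp_inv_step assms(2))

section \<open>Bounds along skyline paths and in the solution graph\<close>

lemma relaxed_if_below_skyline_suffix:
  assumes "pp_inv G c s t st" "opens st = {}" "p @ q \<in> skyline G c s t"
    and le: "\<And>j. lbs st v $ j \<le> ereal (path_cost c q $ j)"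
  shows "relaxed G c (lbs st) v"
proof (rule ccontr)
  assume "\<not> relaxed G c (lbs st) v"
  with assms obtain r where r: "pre_digraph.apath G s r t"
      "dominates (\<chi> i. ereal (path_cost c r $ i)) (lbs st v)"
    unfolding pp_inv_def set_dominates_def by blast
  have "set p \<subseteq> parcs G"
    using assms(3) by (auto simp: skyline_def apath_def awalk_def)
  \<comment> \<open>Nonnegative cost of the prefix \<open>p\<close> lifts the bound from the suffix
    \<open>q\<close> to the whole path \<open>p @ q\<close>.\<close>
  then have "0 \<le> path_cost c p $ j" for j
    by (intro path_cost_nonneg) (auto intro: cost_nonneg)
  then have "lbs st v $ j \<le> ereal (path_cost c (p @ q) $ j)" for j
    using le[of j] by (rule_tac order_trans) auto
  with r(2) have "dominates (\<chi> i. ereal (path_cost c r $ i)) (\<chi> i. ereal (path_cost c (p @ q) $ i))"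
    by (auto intro: dominates_le)
  with r(1) assms(3) show False
    unfolding dominates_ereal by (auto simp: skyline_def)
qed

lemma lbs_le_skyline_suffix:
  assumes "pp_inv G c s t st" "opens st = {}" "p @ q \<in> skyline G c s t" "cas v q t"
  shows "lbs st v $ i \<le> ereal (path_cost c q $ i)"
  using assms(3,4)
\<comment> \<open>The first edge of the suffix moves over to the prefix, so \<open>p\<close> varies.
  The criterion varies too, since excluding domination at the next node takes the bound in all
  criteria.\<close>
proof (induction q arbitrary: p v i)
  case Nil
  with assms(1) show ?case by (auto simp: pp_inv_def zero_ereal_def)
next
  case (Cons e q)
  have sky: "(p @ [e]) @ q \<in> skyline G c s t" using Cons.prems by simp
  have le: "lbs st (snd e) $ j \<le> ereal (path_cost c q $ j)" for j
    using Cons.IH[OF sky] Cons.prems by simp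
  have "e \<in> parcs G"
    using sky by (auto simp: skyline_def apath_def awalk_def)
  with relaxed_if_below_skyline_suffix[OF assms(1,2) sky le] Cons.prems
  have "lbs st v $ i \<le> lbs st (snd e) $ i + ereal (c e $ i)"
    by (cases e) (auto simp: relaxed_def)
  also have "\<dots> \<le> ereal (path_cost c q $ i) + ereal (c e $ i)"
    by (intro add_right_mono le)
  finally show ?case by (simp add: add.commute)
qed

text \<open>Some skyline path contains \<open>e\<close>; cutting it just after \<open>e\<close>
  leaves a suffix that starts at \<open>snd e\<close>.\<close>

lemma relaxed_sol_edge:
  assumes "pp_inv G c s t st" "opens st = {}" "e \<in> sol_edges G c s t"
  shows "relaxed G c (lbs st) (snd e)"
proof -
  obtain p q where sky: "(p @ [e]) @ q \<in> skyline G c s t"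
    using assms(3) by (auto simp: sol_edges_def in_set_conv_decomp)
  then have "cas (snd e) q t" by (auto simp: skyline_def apath_def awalk_def)
  with sky show ?thesis
    using assms(1,2) by (blast intro: relaxed_if_below_skyline_suffix lbs_le_skyline_suffix)
qed

text \<open>Consecutive edges may stem from different skyline paths, so the induction passes the
  bound on through \<open>relaxed\<close> at each head rather than through a common suffix.\<close>

lemma lbs_le_sol_walk:
  assumes "pp_inv G c s t st" "opens st = {}" "set p \<subseteq> sol_edges G c s t" "cas v p t"
  shows "lbs st v $ i \<le> ereal (path_cost c p $ i)"
  using assms(3,4)
proof (induction p arbitrary: v)
  case Nil
  with assms(1) show ?case by (auto simp: pp_inv_def zero_ereal_def)
next
  case (Cons e p)
  have "e \<in> parcs G"
    using Cons.prems by (auto simp: sol_edges_def skyline_def apath_def awalk_def)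
  moreover have "relaxed G c (lbs st) (snd e)"
    using Cons.prems assms(1,2) by (auto intro: relaxed_sol_edge)
  ultimately have "lbs st v $ i \<le> lbs st (snd e) $ i + ereal (c e $ i)"
    using Cons.prems by (cases e) (auto simp: relaxed_def)
  also have "\<dots> \<le> ereal (path_cost c p $ i) + ereal (c e $ i)"
    using Cons by (intro add_right_mono) auto
  finally show ?case by (simp add: add.commute)
qed

end

theorem lemma5:
  fixes G :: "'v pair_pre_digraph" and c :: "'v \<times> 'v \<Rightarrow> real ^ 'd::finite"
    and s t n :: 'v and P :: "('v \<times> 'v) list set" and lb :: "'v \<Rightarrow> ereal ^ 'd"
    and i :: 'd and p :: "('v \<times> 'v) list"
  assumes "multicost_network G c"
    and "s \<in> pverts G" and "t \<in> pverts G"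
    and "pareto_prep G c s t P lb"
    and "n \<in> pverts (sol_graph G c s t)"
    and "shortest_path (sol_graph G c s t) c i n p t"
  shows "lb n $ i \<le> ereal (path_cost c p $ i)"
proof -
  interpret multicost_network G c by fact
  obtain st where st: "(pp_step G c s t)\<^sup>*\<^sup>* (pp_init t) st" "opens st = {}" "lb = lbs st"
    using assms(4) by (auto simp: pareto_prep_def)
  \<comment> \<open>Both graphs have the projections as tail and head maps, so \<open>cas\<close>
    carries over from the solution graph to \<open>G\<close>.\<close>
  have "set p \<subseteq> sol_edges G c s t" "cas n p t"
    using assms(6)
    by (auto simp: shortest_path_def pre_digraph.apath_def pre_digraph.awalk_def sol_graph_def
        Pair_Digraph.cas_with_proj_eq)
  then show ?thesis
    unfolding st(3) using pp_inv_reachable[OF st(1) assms(2)] st(2) by (blast intro: lbs_le_sol_walk)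
qed

end
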